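(* For all $s\in[0,1]$, $u'(s)$ is either $0$, or $\infty$, or not defined at all. (In particular $u'(s)$ is never a finite nonzero vector.)
   Context: Let $M_0 = \frac{1}{5}\begin{pmatrix} 5 & 2 & 2\\ 0 & 2 & 1\\ 0 & 1 & 2 \end{pmatrix}$ and $M_1 = \frac{1}{5}\begin{pmatrix} 2 & 0 & 1\\ 2 & 5 & 2\\ 1 & 0 & 2 \end{pmatrix}$, and let $h_0(x) = \frac{x}{2}$, $h_1(x) = \frac{x+1}{2}$. Let $u:[0,1]\to\mathbb{R}^3$ be the unique continuous function satisfying $u(0) = (1,0,0)^T$, $u(1) = (0,1,0)^T$, $u\circ h_0 = M_0\circ u$ and $u \circ h_1 = M_1\circ u$ on $[0,1]$ (this function is known to exist and to be unique). The derivative $u'(s)$ is the limit of $\frac{u(t)-u(s)}{t-s}$ as $t\to s$, $t\in[0,1]\setminus\{s\}$, if this limit exists in $\mathbb{R}^3$; one also writes $u'(s)=\infty$ if $\lim_{t\to s}\frac{\|u(t)-u(s)\|}{|t-s|} = \infty$ (for any norm on $\mathbb{R}^3$). In all other cases $u'(s)$ is undefined. *)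

theory Defs
  imports "HOL-Analysis.Analysis"
begin

definition M0 :: "real^3^3" where
  "M0 = (1 / 5) *\<^sub>R vector
     [vector [5, 2, 2],
      vector [0, 2, 1],
      vector [0, 1, 2]]"

definition M1 :: "real^3^3" where
  "M1 = (1 / 5) *\<^sub>R vector
     [vector [2, 0, 1],
      vector [2, 5, 2],
      vector [1, 0, 2]]"

definition h0 :: "real \<Rightarrow> real" where
  "h0 x = x / 2"

definition h1 :: "real \<Rightarrow> real" where
  "h1 x = (x + 1) / 2"

(* Only the values of u on the unit interval are constrained. *)
definition is_solution :: "(real \<Rightarrow> real^3) \<Rightarrow> bool" where
  "is_solution u \<longleftrightarrow>
     continuous_on {0..1} u \<and>
     u 0 = vector [1, 0, 0] \<and> u 1 = vector [0, 1, 0] \<and>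
     (\<forall>x\<in>{0..1}. u (h0 x) = M0 *v u x) \<and>
     (\<forall>x\<in>{0..1}. u (h1 x) = M1 *v u x)"

definition has_deriv :: "(real \<Rightarrow> real^3) \<Rightarrow> real \<Rightarrow> real^3 \<Rightarrow> bool" where
  "has_deriv u s d \<longleftrightarrow> (u has_vector_derivative d) (at s within {0..1})"

(* All norms on R^3 are equivalent, so the Euclidean one can be used here. *)
definition has_infinite_deriv :: "(real \<Rightarrow> real^3) \<Rightarrow> real \<Rightarrow> bool" where
  "has_infinite_deriv u s \<longleftrightarrow>
     filterlim (\<lambda>t. norm (u t - u s) / \<bar>t - s\<bar>) at_top (at s within {0..1})"

definition deriv_undefined :: "(real \<Rightarrow> real^3) \<Rightarrow> real \<Rightarrow> bool" where
  "deriv_undefined u s \<longleftrightarrow> \<not> (\<exists>d. has_deriv u s d) \<and> \<not> has_infinite_deriv u s"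

lemma has_deriv_iff_difference_quotient:
  "has_deriv u s d \<longleftrightarrow>
     ((\<lambda>t. (u t - u s) /\<^sub>R (t - s)) \<longlongrightarrow> d) (at s within {0..1})"
proof -
  have "has_deriv u s d \<longleftrightarrow>
      ((\<lambda>t. norm (u t - u s - (t - s) *\<^sub>R d) / norm (t - s)) \<longlongrightarrow> 0) (at s within {0..1})"
    by (simp add: has_deriv_def has_vector_derivative_def has_derivative_iff_norm
        bounded_linear_scaleR_left)
  also have "\<dots> \<longleftrightarrow>
      ((\<lambda>t. norm ((u t - u s) /\<^sub>R (t - s) - d)) \<longlongrightarrow> 0) (at s within {0..1})"
  proof (rule Lim_cong_within)
    fix t :: real assume "t \<noteq> s"
    then have "(u t - u s) /\<^sub>R (t - s) - d = (u t - u s - (t - s) *\<^sub>R d) /\<^sub>R (t - s)"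
      by (simp add: scaleR_diff_right)
    then show "norm (u t - u s - (t - s) *\<^sub>R d) / norm (t - s) =
        norm ((u t - u s) /\<^sub>R (t - s) - d)"
      by (simp add: divide_inverse)
  qed simp_all
  also have "\<dots> \<longleftrightarrow> ((\<lambda>t. (u t - u s) /\<^sub>R (t - s)) \<longlongrightarrow> d) (at s within {0..1})"
    by (simp only: tendsto_norm_zero_iff LIM_zero_iff)
  finally show ?thesis .
qed

end

theory Submission
  imports Defs
begin

text \<open>
  A finite nonzero derivative would make \<open>u\<close> look affine on all small intervals around \<open>s\<close>. But
  \<open>u\<close> restricted to any dyadic interval is a linear image of \<open>u\<close> on \<open>[0,1]\<close>, so every linear
  relation between values of \<open>u\<close> on \<open>[0,1]\<close> reappears, with the same coefficients, at the
  corresponding points of every dyadic interval. As \<open>u\<close> takes values in \<open>\<real>\<^sup>3\<close>, any four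
  values are linearly dependent; for the points \<open>0, 1/4, 1/2, 1\<close> the relation is
  \<open>u (1/4) = 8/25 u 0 + 4/5 u (1/2) - 3/25 u 1\<close>.
  The coefficients on the right sum to \<open>1\<close>, but their first moment is \<open>2/5 - 3/25 = 7/25\<close>, not
  \<open>1/4\<close>: constants satisfy the relation, nonconstant affine functions do not. Applied to the
  dyadic intervals that shrink to \<open>s\<close>, the relation therefore gives \<open>(7/25 - 1/4) d = 0\<close> for any
  derivative \<open>d\<close> at \<open>s\<close> (lemma \<open>zero_derivative_if_scaled_relation\<close>), even when \<open>s\<close> is
  an end point of the unit interval or a dyadic rational.
\<close>

text \<open>
  Expanding \<open>f\<close> to first order at \<open>s\<close> in the relation, the values \<open>f s\<close> cancel because the
  weights sum to \<open>1\<close>; what remains is \<open>h\<close> times a fixed multiple of \<open>d\<close>, balanced by error terms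
  that are \<open>o(h)\<close>. Having \<open>s\<close> inside the interval keeps all four points within distance \<open>h\<close>
  of \<open>s\<close>.
\<close>

lemma zero_derivative_if_scaled_relation:
  fixes f :: "real \<Rightarrow> 'a::real_normed_vector"
  assumes deriv: "(f has_vector_derivative d) (at s within S)"
    and weights: "\<alpha> + \<beta> + \<gamma> = 1"
    and moment: "\<beta> / 2 + \<gamma> \<noteq> 1 / 4"
    and relation: "\<And>\<delta>. \<delta> > 0 \<Longrightarrow> \<exists>a h. 0 < h \<and> h < \<delta> \<and> a \<le> s \<and> s \<le> a + h \<and> {a..a + h} \<subseteq> S \<and>
          f (a + h / 4) = \<alpha> *\<^sub>R f a + \<beta> *\<^sub>R f (a + h / 2) + \<gamma> *\<^sub>R f (a + h)"
  shows "d = 0"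
proof (rule ccontr)
  assume "d \<noteq> 0"
  define m where "m = \<beta> / 2 + \<gamma> - 1 / 4"
  define C where "C = 1 + \<bar>\<alpha>\<bar> + \<bar>\<beta>\<bar> + \<bar>\<gamma>\<bar>"
  \<comment> \<open>The relation forces \<open>\<bar>m\<bar> * norm d \<le> C * e\<close>; this \<open>e\<close> is half of what that needs.\<close>
  define e where "e = \<bar>m\<bar> * norm d / (2 * C)"
  have "C > 0" by (simp add: C_def)
  have md: "\<bar>m\<bar> * norm d > 0" using moment \<open>d \<noteq> 0\<close> by (simp add: m_def)
  have "e > 0" using md \<open>C > 0\<close> by (simp add: e_def)
  define R where "R t = f t - f s - (t - s) *\<^sub>R d" for t
  have "\<exists>\<delta>>0. \<forall>t\<in>S. norm (t - s) < \<delta> \<longrightarrow> norm (R t) \<le> e * norm (t - s)"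
    using deriv \<open>e > 0\<close>
    by (simp add: has_vector_derivative_def has_derivative_within_alt R_def)
  then obtain \<delta> where \<delta>: "\<delta> > 0"
      and small: "\<And>t. t \<in> S \<Longrightarrow> norm (t - s) < \<delta> \<Longrightarrow> norm (R t) \<le> e * norm (t - s)"
    by blast
  obtain a h where h: "0 < h" "h < \<delta>" and s: "a \<le> s" "s \<le> a + h" and sub: "{a..a + h} \<subseteq> S"
    and rel: "f (a + h / 4) = \<alpha> *\<^sub>R f a + \<beta> *\<^sub>R f (a + h / 2) + \<gamma> *\<^sub>R f (a + h)"
    using relation[OF \<delta>] by blast
  have R: "norm (R t) \<le> e * h" if "a \<le> t" "t \<le> a + h" for t
  proof -
    have "norm (R t) \<le> e * norm (t - s)"
      using that s h sub by (intro small) auto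
    also have "\<dots> \<le> e * h"
      using that s \<open>e > 0\<close> by (intro mult_left_mono) auto
    finally show ?thesis .
  qed
  have \<alpha>: "\<alpha> = 1 - \<beta> - \<gamma>" using weights by simp
  have "(h * m) *\<^sub>R d = R (a + h / 4) - \<alpha> *\<^sub>R R a - \<beta> *\<^sub>R R (a + h / 2) - \<gamma> *\<^sub>R R (a + h)"
    unfolding R_def rel \<alpha> m_def by (simp add: algebra_simps)
  also have "norm \<dots> \<le> norm (R (a + h / 4)) + \<bar>\<alpha>\<bar> * norm (R a) + \<bar>\<beta>\<bar> * norm (R (a + h / 2))
                   + \<bar>\<gamma>\<bar> * norm (R (a + h))"
    by (intro norm_triangle_le_diff add_mono) auto
  also have "\<dots> \<le> e * h + \<bar>\<alpha>\<bar> * (e * h) + \<bar>\<beta>\<bar> * (e * h) + \<bar>\<gamma>\<bar> * (e * h)"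
    using h by (intro add_mono mult_left_mono R) auto
  also have "\<dots> = C * e * h" by (simp add: C_def algebra_simps)
  also have "\<dots> = (\<bar>m\<bar> * norm d / 2) * h" using \<open>C > 0\<close> by (simp add: e_def)
  finally have "h * (\<bar>m\<bar> * norm d) \<le> h * (\<bar>m\<bar> * norm d) / 2"
    using h by (simp add: abs_mult mult_ac)
  then show False using mult_pos_pos[OF h(1) md] by linarith
qed

lemma dyadic_piece_linear:
  assumes "is_solution u" and "k < 2 ^ n"
  shows "\<exists>P :: real^3^3. \<forall>x\<in>{0..1}. u ((real k + x) / 2 ^ n) = P *v u x"
  using assms(2)
proof (induction n arbitrary: k)
  case 0
  then show ?case by (intro exI[of _ "mat 1"]) simp
next
  case (Suc n)
  have unit: "(real j + x) / 2 ^ n \<in> {0..1}" if "j < 2 ^ n" "x \<in> {0..1}" for j x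
  proof -
    have "real (Suc j) \<le> real (2 ^ n)" using that(1) by (intro of_nat_mono) simp
    then show ?thesis using that(2) by (simp add: field_simps)
  qed
  \<comment> \<open>The leading binary digit of \<open>k\<close> is the last map applied.\<close>
  show ?case
  proof (cases "k < 2 ^ n")
    case True
    then obtain P :: "real^3^3" where P: "\<forall>x\<in>{0..1}. u ((real k + x) / 2 ^ n) = P *v u x"
      using Suc.IH by blast
    have "u ((real k + x) / 2 ^ Suc n) = (M0 ** P) *v u x" if "x \<in> {0..1}" for x
    proof -
      have "(real k + x) / 2 ^ Suc n = h0 ((real k + x) / 2 ^ n)" by (simp add: h0_def)
      then show ?thesis
        using assms(1) unit[OF True that] P that
        by (simp add: is_solution_def matrix_vector_mul_assoc)
    qed
    then show ?thesis by blast
  next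
    case False
    define j where "j = k - 2 ^ n"
    have j: "j < 2 ^ n" "k = j + 2 ^ n" using False Suc.prems by (auto simp: j_def)
    then obtain P :: "real^3^3" where P: "\<forall>x\<in>{0..1}. u ((real j + x) / 2 ^ n) = P *v u x"
      using Suc.IH by blast
    have "u ((real k + x) / 2 ^ Suc n) = (M1 ** P) *v u x" if "x \<in> {0..1}" for x
    proof -
      have "(real k + x) / 2 ^ Suc n = h1 ((real j + x) / 2 ^ n)"
        by (simp add: h1_def j(2) field_simps)
      then show ?thesis
        using assms(1) unit[OF j(1) that] P that
        by (simp add: is_solution_def matrix_vector_mul_assoc)
    qed
    then show ?thesis by blast
  qed
qed

text \<open>
  The values \<open>u (1/2) = M0 u 1 = (2,2,1)/5\<close> and \<open>u (1/4) = M0 u (1/2) = (16,5,4)/25\<close> determine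
  the coefficients: the third coordinate gives \<open>4/5\<close>, the other two then give \<open>8/25\<close> and \<open>-3/25\<close>.
\<close>

lemma unit_interval_relation:
  assumes "is_solution u"
  shows "u (1 / 4) = (8 / 25) *\<^sub>R u 0 + (4 / 5) *\<^sub>R u (1 / 2) + (- 3 / 25) *\<^sub>R u 1"
proof -
  have u: "u 0 = vector [1, 0, 0]" "u 1 = vector [0, 1, 0]"
    and step: "\<And>x. x \<in> {0..1} \<Longrightarrow> u (h0 x) = M0 *v u x"
    using assms by (auto simp: is_solution_def)
  have half: "u (1 / 2) = M0 *v u 1" using step[of 1] by (simp add: h0_def)
  have quarter: "u (1 / 4) = M0 *v u (1 / 2)" using step[of "1 / 2"] by (simp add: h0_def)
  show ?thesis
    unfolding quarter half u
    by (simp add: vec_eq_iff forall_3 sum_3 matrix_vector_mult_def M0_def)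
qed

lemma dyadic_interval_relation:
  assumes "is_solution u" and "k < 2 ^ n" and a: "a = real k / 2 ^ n" and h: "h = 1 / 2 ^ n"
  shows "u (a + h / 4) = (8 / 25) *\<^sub>R u a + (4 / 5) *\<^sub>R u (a + h / 2) + (- 3 / 25) *\<^sub>R u (a + h)"
proof -
  obtain P :: "real^3^3" where P: "\<forall>x\<in>{0..1}. u ((real k + x) / 2 ^ n) = P *v u x"
    using dyadic_piece_linear[OF assms(1,2)] by blast
  have eq: "u (a + h * x) = P *v u x" if "x \<in> {0..1}" for x
    using P that by (simp add: a h add_divide_distrib)
  have "u (a + h / 4) = P *v u (1 / 4)" "u a = P *v u 0" "u (a + h / 2) = P *v u (1 / 2)"
    "u (a + h) = P *v u 1"
    using eq[of "1 / 4"] eq[of 0] eq[of "1 / 2"] eq[of 1] by simp_all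
  then show ?thesis
    unfolding unit_interval_relation[OF assms(1)]
    by (simp only: matrix_vector_right_distrib matrix_vector_mult_scaleR)
qed

lemma dyadic_interval_containing:
  fixes s :: real
  assumes "s \<in> {0..1}"
  shows "\<exists>k < 2 ^ n. real k / 2 ^ n \<le> s \<and> s \<le> real k / 2 ^ n + 1 / 2 ^ n"
proof (cases "s = 1")
  case True
  \<comment> \<open>The floor of \<open>2 ^ n * s\<close> would be \<open>2 ^ n\<close> here; the last interval is closed on the right.\<close>
  show ?thesis
    by (rule exI[of _ "2 ^ n - 1"]) (simp add: True of_nat_diff field_simps)
next
  case False
  define k where "k = nat \<lfloor>s * 2 ^ n\<rfloor>"
  have k: "real k = of_int \<lfloor>s * 2 ^ n\<rfloor>" using assms by (simp add: k_def)
  have le: "real k \<le> s * 2 ^ n" and ge: "s * 2 ^ n \<le> real k + 1"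
    unfolding k by linarith+
  have "s * 2 ^ n < 2 ^ n" using assms False by simp
  then have "real k < 2 ^ n" using le by linarith
  then have "k < 2 ^ n" by simp
  then show ?thesis using le ge by (intro exI[of _ k]) (simp add: field_simps)
qed

lemma derivative_zero:
  assumes u: "is_solution u" and s: "s \<in> {0..1}" and d: "has_deriv u s d"
  shows "d = 0"
proof (rule zero_derivative_if_scaled_relation)
  show "(u has_vector_derivative d) (at s within {0..1})"
    using d by (simp add: has_deriv_def)
next
  fix \<delta> :: real assume "\<delta> > 0"
  then obtain n where n: "1 / 2 ^ n < \<delta>"
    using real_arch_pow_inv[of \<delta> "1 / 2"] by (auto simp: power_one_over)
  obtain k where k: "k < 2 ^ n" and le: "real k / 2 ^ n \<le> s" "s \<le> real k / 2 ^ n + 1 / 2 ^ n"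
    using dyadic_interval_containing[OF s] by blast
  have "real (Suc k) \<le> real (2 ^ n)" using k by (intro of_nat_mono) simp
  then have "{real k / 2 ^ n..real k / 2 ^ n + 1 / 2 ^ n} \<subseteq> {0..1}"
    by (auto simp: field_simps intro: order_trans[rotated])
  then show "\<exists>a h. 0 < h \<and> h < \<delta> \<and> a \<le> s \<and> s \<le> a + h \<and> {a..a + h} \<subseteq> {0..1} \<and>
      u (a + h / 4) = (8 / 25) *\<^sub>R u a + (4 / 5) *\<^sub>R u (a + h / 2) + (- 3 / 25) *\<^sub>R u (a + h)"
    using n le dyadic_interval_relation[OF u k refl refl]
    by (intro exI[of _ "real k / 2 ^ n"] exI[of _ "1 / 2 ^ n"]) simp
qed simp_all

theorem theorem16:
  fixes u :: "real \<Rightarrow> real^3"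
  assumes "is_solution u"
  shows "\<forall>s\<in>{0..1}.
           (has_deriv u s 0 \<or> has_infinite_deriv u s \<or> deriv_undefined u s) \<and>
           \<not> (\<exists>d. d \<noteq> 0 \<and> has_deriv u s d)"
  using derivative_zero[OF assms] unfolding deriv_undefined_def by blast

end
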